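(* Let $(X,d)$ be a complete controlled rectangular metric space with control function $\alpha: X\times X\to[1,+\infty[$, and let $T:X\to X$ be a self-mapping. Suppose there exists $\lambda$ with $0<\lambda<\frac13$ such that for all $x,y\in X$, $$d(Tx,Ty)\leq \lambda\left[d(x,y)+d(x,Tx)+d(y,Ty)\right].$$ Let $x_0\in X$ and put $x_n=T^n x_0$ for $n\in\mathbb{N}$. Suppose that $$\sup_{m\geq 1}\ \lim_{i\to\infty}\ \alpha(x_{i},x_m)\,\frac{\alpha(x_{i+1},x_{i+2})+\alpha(x_{i+2},x_{i+3})}{\alpha(x_i,x_{i+1})+\alpha(x_{i+1},x_{i+2})}<\frac{1}{\lambda^2}.$$ Assume moreover that for every $x\in X$ the limits $$\lim_{n\to+\infty}\alpha(x_n,x),\qquad \lim_{n\to+\infty}\alpha(x,x_n),\qquad \lim_{n,m\to+\infty,\ n\neq m}\alpha(x_n,x_m)$$ exist and are finite, and that for every $x\in X$ $$\lim_{n\to+\infty}\alpha(x_n,T^2x_n)<\frac1\lambda,\qquad \lim_{n\to+\infty}\alpha(Tx_n,Tx)<\frac1\lambda,\qquad \lim_{n\to+\infty}\alpha(Tx,Tx_n)<\frac1\lambda.$$ Then $T$ has a unique fixed point in $X$.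
   Context: Let $X$ be a non-empty set and $\alpha:X\times X\to[1,+\infty[$ a function. A function $d:X\times X\to[0,+\infty[$ is called a controlled rectangular metric (with control function $\alpha$), and $(X,d)$ a controlled rectangular metric space, if: ($d_1$) for all $x,y\in X$, $d(x,y)=0$ if and only if $x=y$; ($d_2$) for all $x,y\in X$, $d(x,y)=d(y,x)$; ($d_3$) for all pairwise distinct $x,y,u,v\in X$, $d(x,y)\leq\alpha(x,u)d(x,u)+\alpha(u,v)d(u,v)+\alpha(v,y)d(v,y)$. (The function $\alpha$ is not assumed symmetric.) A sequence $\{x_n\}$ in $X$ converges to $x\in X$ if $\lim_{n\to\infty}d(x_n,x)=0$; it is Cauchy if for every $\varepsilon>0$ there is a positive integer $N$ such that $d(x_n,x_m)<\varepsilon$ for all $n,m\geq N$. The space $(X,d)$ is complete if every Cauchy sequence in $X$ converges to some point of $X$. *)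

theory Defs
  imports Complex_Main "HOL-Library.Extended_Real"
begin

text \<open>As with the library's \<open>Metric_space\<close>, the space is a carrier set \<open>X\<close>; \<open>d\<close> and the control
  function \<open>\<alpha>\<close> are constrained only on \<open>X\<close>. Neither symmetry of \<open>\<alpha>\<close> nor the triangle
  inequality for \<open>d\<close> is assumed.\<close>

locale controlled_rectangular_metric_space =
  fixes X :: "'a set" and d :: "'a \<Rightarrow> 'a \<Rightarrow> real" and \<alpha> :: "'a \<Rightarrow> 'a \<Rightarrow> real"
  assumes nonempty: "X \<noteq> {}"
    and control_ge_1: "\<And>x y. x \<in> X \<Longrightarrow> y \<in> X \<Longrightarrow> 1 \<le> \<alpha> x y"
    and nonneg: "\<And>x y. x \<in> X \<Longrightarrow> y \<in> X \<Longrightarrow> 0 \<le> d x y"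
    and zero_iff: "\<And>x y. x \<in> X \<Longrightarrow> y \<in> X \<Longrightarrow> d x y = 0 \<longleftrightarrow> x = y"
    and commute: "\<And>x y. x \<in> X \<Longrightarrow> y \<in> X \<Longrightarrow> d x y = d y x"
    and rectangle: "\<And>x y u v. {x, y, u, v} \<subseteq> X \<Longrightarrow> distinct [x, y, u, v] \<Longrightarrow>
      d x y \<le> \<alpha> x u * d x u + \<alpha> u v * d u v + \<alpha> v y * d v y"

definition seq_converges_to :: "('a \<Rightarrow> 'a \<Rightarrow> real) \<Rightarrow> (nat \<Rightarrow> 'a) \<Rightarrow> 'a \<Rightarrow> bool" where
  "seq_converges_to d s x \<longleftrightarrow> (\<lambda>n. d (s n) x) \<longlonglongrightarrow> 0"

definition seq_Cauchy :: "('a \<Rightarrow> 'a \<Rightarrow> real) \<Rightarrow> (nat \<Rightarrow> 'a) \<Rightarrow> bool" where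
  "seq_Cauchy d s \<longleftrightarrow> (\<forall>\<epsilon>>0. \<exists>N>0. \<forall>n\<ge>N. \<forall>m\<ge>N. d (s n) (s m) < \<epsilon>)"

definition seq_complete :: "'a set \<Rightarrow> ('a \<Rightarrow> 'a \<Rightarrow> real) \<Rightarrow> bool" where
  "seq_complete X d \<longleftrightarrow>
    (\<forall>s. range s \<subseteq> X \<and> seq_Cauchy d s \<longrightarrow> (\<exists>x\<in>X. seq_converges_to d s x))"

definition off_diagonal_at_top :: "(nat \<times> nat) filter" where
  "off_diagonal_at_top =
    inf (sequentially \<times>\<^sub>F sequentially) (principal {(n, m). n \<noteq> m})"

end

theory Submission
  imports Defs
begin

text \<open>
  Write \<open>x\<^sub>n\<close> for the orbit of \<open>x\<^sub>0\<close> and \<open>k = 2l/(1 - l) < 1\<close>. Applying the contraction inequality to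
  \<open>y\<close> and \<open>T y\<close> shows that displacements \<open>d y (T y)\<close> shrink by the factor \<open>k\<close> under \<open>T\<close>; applying it to
  arbitrary \<open>y\<close> and \<open>z\<close> then gives
  \<open>d (T\<^sup>n y) (T\<^sup>n z) \<le> k\<^sup>n (d y z + d y (T y) + d z (T z))\<close> (\<open>iterates_dist_le\<close>).
  In particular, for each fixed \<open>j\<close> the distance from \<open>x\<^sub>n\<close> to \<open>x\<^bsub>n+j\<^esub>\<close> tends to 0. If the orbit
  repeats a value, the decay of displacements makes that value a fixed point, so the orbit may be taken
  injective, as the rectangle inequality requires.

  The orbit is Cauchy because of the quadrilateral \<open>x\<^sub>n, x\<^bsub>n+j\<^esub>, x\<^bsub>m+j\<^esub>, x\<^sub>m\<close>. Off the diagonal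
  the control function is eventually bounded on the orbit, by \<open>A\<close> say. In the rectangle inequality the
  middle side is \<open>T\<^sup>j\<close> applied to both ends of the side to be estimated, so with \<open>j\<close> so
  large that \<open>A k\<^sup>j \<le> 1/2\<close> it contributes at most half of \<open>d x\<^sub>n x\<^sub>m\<close>, plus displacements, and is
  absorbed into the left-hand side. The two outer sides have fixed gap \<open>j\<close> and tend to 0
  (\<open>orbit_dist_le\<close>).

  Let \<open>z\<close> be the limit. The contraction inequality bounds \<open>d x\<^bsub>n+1\<^esub> (T z)\<close> asymptotically by
  \<open>l d z (T z)\<close>. If \<open>T z \<noteq> z\<close>, then the rectangle inequality on \<open>z, x\<^sub>n, x\<^bsub>n+1\<^esub>, T z\<close> gives in the
  limit \<open>d z (T z) \<le> c l d z (T z)\<close>, where \<open>c < 1/l\<close> is the limit of the last control factor: a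
  contradiction (\<open>orbit_limit_fixed\<close>). Two fixed points \<open>y, z\<close> satisfy \<open>d y z \<le> l d y z\<close>
  and therefore coincide.
\<close>

section \<open>Contraction estimates for iterates\<close>

locale reich_contraction = controlled_rectangular_metric_space +
  fixes T :: "'a \<Rightarrow> 'a" and l :: real
  assumes self_map: "y \<in> X \<Longrightarrow> T y \<in> X"
    and l_pos: "0 < l" and l_less: "l < 1 / 3"
    and contraction:
      "\<lbrakk>y \<in> X; z \<in> X\<rbrakk> \<Longrightarrow> d (T y) (T z) \<le> l * (d y z + d y (T y) + d z (T z))"
begin

definition ratio :: real where
  "ratio = 2 * l / (1 - l)"

lemma ratio_pos: "0 < ratio"
  and ratio_less_1: "ratio < 1"
  and twice_l_le_ratio: "2 * l \<le> ratio"
  using l_pos l_less by (auto simp: ratio_def field_simps)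

lemma iterate_in: "y \<in> X \<Longrightarrow> (T ^^ n) y \<in> X"
  by (induction n) (auto simp: self_map)

lemma displacement_le:
  assumes "y \<in> X"
  shows "d (T y) (T (T y)) \<le> ratio * d y (T y)"
proof -
  have "d (T y) (T (T y)) \<le> l * (d y (T y) + d y (T y) + d (T y) (T (T y)))"
    using assms by (intro contraction self_map)
  then have "(1 - l) * d (T y) (T (T y)) \<le> 2 * l * d y (T y)"
    by (simp add: algebra_simps)
  then show ?thesis
    using l_less by (simp add: ratio_def field_simps)
qed

lemma displacement_iterate_le:
  assumes "y \<in> X"
  shows "d ((T ^^ n) y) ((T ^^ Suc n) y) \<le> ratio ^ n * d y (T y)"
proof (induction n)
  case 0
  show ?case by simp
next
  case (Suc n)
  have "d ((T ^^ Suc n) y) ((T ^^ Suc (Suc n)) y) \<le> ratio * d ((T ^^ n) y) ((T ^^ Suc n) y)"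
    using displacement_le[OF iterate_in[OF assms, of n]] by simp
  also have "\<dots> \<le> ratio * (ratio ^ n * d y (T y))"
    using Suc ratio_pos by (intro mult_left_mono) auto
  finally show ?case by (simp add: mult.assoc)
qed

text \<open>One application of \<open>T\<close> multiplies by \<open>l\<close> the distance plus the two displacements. After \<open>n\<close>
  steps each of these two parts is at most \<open>ratio ^ n\<close> times the constant, the first by induction
  and the second by the decay of displacements; so \<open>2 * l \<le> ratio\<close> closes the induction.\<close>

lemma iterates_dist_le:
  assumes "y \<in> X" "z \<in> X"
  shows "d ((T ^^ n) y) ((T ^^ n) z) \<le> ratio ^ n * (d y z + d y (T y) + d z (T z))"
    (is "_ \<le> _ * ?C")
proof (induction n)
  case 0
  show ?case using assms by (simp add: nonneg self_map)
next
  case (Suc n)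
  let ?y = "(T ^^ n) y" and ?z = "(T ^^ n) z"
  have "d ?y (T ?y) + d ?z (T ?z) \<le> ratio ^ n * (d y (T y) + d z (T z))"
    using displacement_iterate_le[OF assms(1), of n] displacement_iterate_le[OF assms(2), of n]
    by (simp add: distrib_left)
  also have "\<dots> \<le> ratio ^ n * ?C"
    using assms ratio_pos by (intro mult_left_mono) (auto simp: nonneg)
  finally have sum_le: "d ?y ?z + d ?y (T ?y) + d ?z (T ?z) \<le> 2 * (ratio ^ n * ?C)"
    using Suc by linarith
  have "d (T ?y) (T ?z) \<le> l * (d ?y ?z + d ?y (T ?y) + d ?z (T ?z))"
    using assms by (intro contraction iterate_in)
  also have "\<dots> \<le> l * (2 * (ratio ^ n * ?C))"
    using l_pos by (intro mult_left_mono sum_le) auto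
  also have "\<dots> = (2 * l) * (ratio ^ n * ?C)"
    by (simp only: mult_ac)
  also have "\<dots> \<le> ratio * (ratio ^ n * ?C)"
    using assms ratio_pos twice_l_le_ratio
    by (intro mult_right_mono) (auto simp: nonneg self_map)
  finally show ?case by (simp add: mult.assoc)
qed

section \<open>Fixed points and periodic points\<close>

lemma fixed_points_unique:
  assumes "y \<in> X" "z \<in> X" "T y = y" "T z = z"
  shows "y = z"
proof -
  have "d y y = 0" "d z z = 0"
    using assms by (simp_all add: zero_iff)
  then have "d y z \<le> l * d y z"
    using contraction[of y z] assms by simp
  moreover have "l * d y z \<le> 1 / 3 * d y z"
    using l_less assms by (intro mult_right_mono) (auto simp: nonneg)
  ultimately have "d y z = 0"
    using nonneg[of y z] assms by linarith
  then show ?thesis using assms zero_iff by simp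
qed

text \<open>On a cycle of length \<open>p\<close> the displacement would be at most \<open>ratio ^ p\<close> times itself.\<close>

lemma periodic_point_fixed:
  assumes y: "y \<in> X" and "p > 0" and period: "(T ^^ p) y = y"
  shows "T y = y"
proof -
  have "d y (T y) \<le> ratio ^ p * d y (T y)"
    using displacement_iterate_le[OF y, of p] period by simp
  then have "(1 - ratio ^ p) * d y (T y) \<le> 0"
    by (simp add: left_diff_distrib)
  moreover have "ratio ^ p < 1"
    using ratio_pos ratio_less_1 \<open>p > 0\<close> by (simp add: power_less_one_iff)
  ultimately have "d y (T y) \<le> 0"
    by (simp add: mult_le_0_iff)
  then have "d y (T y) = 0"
    using nonneg[OF y self_map[OF y]] by linarith
  then show ?thesis using zero_iff[OF y self_map[OF y]] by simp
qed

lemma orbit_inj_if_no_fixed_point: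
  assumes "y \<in> X" and no_fixed: "\<And>z. z \<in> X \<Longrightarrow> T z \<noteq> z"
  shows "inj (\<lambda>n. (T ^^ n) y)"
proof -
  have "(T ^^ n) y \<noteq> (T ^^ m) y" if "n < m" for n m
  proof
    assume eq: "(T ^^ n) y = (T ^^ m) y"
    have "(T ^^ (m - n)) ((T ^^ n) y) = (T ^^ (m - n + n)) y"
      by (simp only: funpow_add comp_apply)
    also have "\<dots> = (T ^^ n) y"
      using that eq by simp
    finally have "(T ^^ (m - n)) ((T ^^ n) y) = (T ^^ n) y" .
    then show False
      using periodic_point_fixed[of "(T ^^ n) y" "m - n"] no_fixed that iterate_in \<open>y \<in> X\<close>
      by simp
  qed
  then show ?thesis by (intro linorder_injI) auto
qed

section \<open>Orbits are Cauchy\<close>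

lemma orbit_gap_tendsto_0:
  assumes "y \<in> X"
  shows "(\<lambda>n. d ((T ^^ n) y) ((T ^^ (n + j)) y)) \<longlonglongrightarrow> 0"
proof (rule tendsto_sandwich[OF always_eventually always_eventually tendsto_const])
  let ?C = "d y ((T ^^ j) y) + d y (T y) + d ((T ^^ j) y) (T ((T ^^ j) y))"
  show "\<forall>n. d ((T ^^ n) y) ((T ^^ (n + j)) y) \<le> ratio ^ n * ?C"
    using iterates_dist_le[OF assms iterate_in[OF assms, of j]] by (simp add: funpow_add)
  show "\<forall>n. 0 \<le> d ((T ^^ n) y) ((T ^^ (n + j)) y)"
    using assms by (simp add: nonneg iterate_in)
  show "(\<lambda>n. ratio ^ n * ?C) \<longlonglongrightarrow> 0"
    using ratio_pos ratio_less_1 by (intro tendsto_mult_left_zero LIMSEQ_realpow_zero) auto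
qed

text \<open>The rectangle with vertices at the times \<open>n\<close>, \<open>n + j\<close>, \<open>m + j\<close>, \<open>m\<close> bounds the distance by two
  sides with time gap \<open>j\<close> and by a middle side that is at most half of the distance itself, up to
  displacements. When two of the four times agree the rectangle degenerates, but then the distance is
  zero or itself a side with gap \<open>j\<close>.\<close>

lemma orbit_dist_le:
  assumes y: "y \<in> X" and inj: "inj (\<lambda>n. (T ^^ n) y)" and "j > 0"
    and bound: "\<And>n m. \<lbrakk>n \<ge> N; m \<ge> N; n \<noteq> m\<rbrakk> \<Longrightarrow> \<alpha> ((T ^^ n) y) ((T ^^ m) y) \<le> A"
    and small: "A * ratio ^ j \<le> 1 / 2"
    and g_def: "\<And>n. g n = 2 * A * d ((T ^^ n) y) ((T ^^ (n + j)) y) + d ((T ^^ n) y) ((T ^^ Suc n) y)"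
    and "n \<ge> N" "m \<ge> N"
  shows "d ((T ^^ n) y) ((T ^^ m) y) \<le> g n + g m"
proof -
  let ?x = "\<lambda>n. (T ^^ n) y"
  have x_in: "?x i \<in> X" for i
    using y by (rule iterate_in)
  have "1 \<le> \<alpha> (?x N) (?x (Suc N))"
    by (intro control_ge_1 x_in)
  also have "\<dots> \<le> A"
    by (intro bound) auto
  finally have "A \<ge> 1" .
  have gap_le_g: "d (?x i) (?x (i + j)) \<le> g i" for i
  proof -
    have "1 * d (?x i) (?x (i + j)) \<le> (2 * A) * d (?x i) (?x (i + j))"
      using \<open>A \<ge> 1\<close> by (intro mult_right_mono nonneg x_in) auto
    then show ?thesis
      using nonneg[OF x_in x_in, of i "Suc i"] unfolding g_def by linarith
  qed
  have g_nonneg: "0 \<le> g i" for i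
    using gap_le_g[of i] nonneg[OF x_in x_in, of i "i + j"] by linarith
  consider "n = m" | "m = n + j" | "n = m + j" | "distinct [n, m, n + j, m + j]"
    using \<open>j > 0\<close> by force
  then show ?thesis
  proof cases
    case 1
    then have "d (?x n) (?x m) = 0"
      using zero_iff[OF x_in x_in] by simp
    then show ?thesis using g_nonneg[of n] g_nonneg[of m] by linarith
  next
    case 2
    then show ?thesis using gap_le_g[of n] g_nonneg[of m] by simp
  next
    case 3
    then show ?thesis
      using gap_le_g[of m] g_nonneg[of n] commute[OF x_in x_in, of n m] by simp
  next
    case 4
    let ?D = "d (?x n) (?x m)" and ?dn = "d (?x n) (?x (Suc n))" and ?dm = "d (?x m) (?x (Suc m))"
    let ?gn = "d (?x n) (?x (n + j))" and ?gm = "d (?x m) (?x (m + j))"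
    have "{?x n, ?x m, ?x (n + j), ?x (m + j)} \<subseteq> X"
      using x_in by blast
    moreover have "distinct [?x n, ?x m, ?x (n + j), ?x (m + j)]"
      using 4 by (auto simp: inj_eq[OF inj])
    ultimately have "?D \<le> \<alpha> (?x n) (?x (n + j)) * ?gn
        + \<alpha> (?x (n + j)) (?x (m + j)) * d (?x (n + j)) (?x (m + j))
        + \<alpha> (?x (m + j)) (?x m) * d (?x (m + j)) (?x m)"
      by (rule rectangle)
    also have "\<dots> \<le> A * ?gn + A * d (?x (n + j)) (?x (m + j)) + A * d (?x (m + j)) (?x m)"
      using 4 \<open>n \<ge> N\<close> \<open>m \<ge> N\<close> by (intro add_mono mult_right_mono bound nonneg x_in) auto
    finally have "?D \<le> A * ?gn + A * d (?x (n + j)) (?x (m + j)) + A * ?gm"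
      by (simp only: commute[OF x_in x_in, of "m + j" m])
    moreover have "A * d (?x (n + j)) (?x (m + j)) \<le> 1 / 2 * (?D + ?dn + ?dm)"
    proof -
      have "(T ^^ j) (?x i) = ?x (i + j)" for i
        by (simp add: add.commute[of i] funpow_add)
      then have "d (?x (n + j)) (?x (m + j)) \<le> ratio ^ j * (?D + ?dn + ?dm)"
        using iterates_dist_le[OF x_in x_in, of j n m] by simp
      then have "A * d (?x (n + j)) (?x (m + j)) \<le> A * (ratio ^ j * (?D + ?dn + ?dm))"
        using \<open>A \<ge> 1\<close> by (intro mult_left_mono) auto
      also have "\<dots> = (A * ratio ^ j) * (?D + ?dn + ?dm)"
        by (simp only: mult.assoc)
      also have "\<dots> \<le> 1 / 2 * (?D + ?dn + ?dm)"
        using small by (intro mult_right_mono add_nonneg_nonneg nonneg x_in)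
      finally show ?thesis .
    qed
    ultimately show ?thesis
      unfolding g_def by argo
  qed
qed

lemma orbit_Cauchy:
  assumes y: "y \<in> X" and inj: "inj (\<lambda>n. (T ^^ n) y)"
    and bound: "\<And>n m. \<lbrakk>n \<ge> N; m \<ge> N; n \<noteq> m\<rbrakk> \<Longrightarrow> \<alpha> ((T ^^ n) y) ((T ^^ m) y) \<le> A"
  shows "seq_Cauchy d (\<lambda>n. (T ^^ n) y)"
proof -
  have "(\<lambda>j. A * ratio ^ j) \<longlonglongrightarrow> 0"
    using ratio_pos ratio_less_1 by (intro tendsto_mult_right_zero LIMSEQ_realpow_zero) auto
  then have "eventually (\<lambda>j. A * ratio ^ j < 1 / 2) sequentially"
    by (rule order_tendstoD) simp
  then have "eventually (\<lambda>j. j > 0 \<and> A * ratio ^ j \<le> 1 / 2) sequentially"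
    using eventually_gt_at_top[of 0] by eventually_elim simp
  then obtain j where "j > 0" and small: "A * ratio ^ j \<le> 1 / 2"
    using eventually_happens'[OF sequentially_bot] by blast
  define g where
    "g n = 2 * A * d ((T ^^ n) y) ((T ^^ (n + j)) y) + d ((T ^^ n) y) ((T ^^ Suc n) y)" for n
  have "g \<longlonglongrightarrow> 2 * A * 0 + 0"
    unfolding g_def using orbit_gap_tendsto_0[OF y, of 1]
    by (intro tendsto_add tendsto_mult tendsto_const orbit_gap_tendsto_0[OF y]) simp
  then have g_0: "g \<longlonglongrightarrow> 0" by simp
  show ?thesis
    unfolding seq_Cauchy_def
  proof (intro allI impI)
    fix \<epsilon> :: real
    assume "\<epsilon> > 0"
    then have "eventually (\<lambda>n. g n < \<epsilon> / 2) sequentially"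
      by (intro order_tendstoD(2)[OF g_0]) simp
    then obtain M where M: "\<And>n. n \<ge> M \<Longrightarrow> g n < \<epsilon> / 2"
      by (auto simp: eventually_sequentially)
    have "d ((T ^^ n) y) ((T ^^ m) y) < \<epsilon>" if "n \<ge> Suc (max M N)" "m \<ge> Suc (max M N)" for n m
    proof -
      have "d ((T ^^ n) y) ((T ^^ m) y) \<le> g n + g m"
      proof (rule orbit_dist_le[OF y inj \<open>j > 0\<close> _ small g_def])
        show "\<alpha> ((T ^^ a) y) ((T ^^ b) y) \<le> A" if "a \<ge> N" "b \<ge> N" "a \<noteq> b" for a b
          using that by (rule bound)
        show "n \<ge> N" "m \<ge> N"
          using that by auto
      qed
      moreover have "g n < \<epsilon> / 2" "g m < \<epsilon> / 2"
        using that by (simp_all only: M Suc_le_eq max_less_iff_conj less_imp_le)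
      ultimately show ?thesis by linarith
    qed
    then show "\<exists>N>0. \<forall>n\<ge>N. \<forall>m\<ge>N. d ((T ^^ n) y) ((T ^^ m) y) < \<epsilon>"
      by blast
  qed
qed

section \<open>Limits of orbits are fixed points\<close>

text \<open>Passing to the limit in the rectangle inequality on \<open>z\<close>, \<open>x\<^sub>n\<close>, \<open>x\<^bsub>n+1\<^esub>\<close>, \<open>T z\<close>
  leaves only the last term; there \<open>d x\<^bsub>n+1\<^esub> (T z)\<close>, not yet known to converge, is first
  replaced by the contraction bound, which tends to \<open>l * d z (T z)\<close>.\<close>

lemma orbit_limit_fixed:
  assumes y: "y \<in> X" and inj: "inj (\<lambda>n. (T ^^ n) y)" and z: "z \<in> X"
    and lim: "(\<lambda>n. d ((T ^^ n) y) z) \<longlonglongrightarrow> 0"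
    and first: "convergent (\<lambda>n. \<alpha> z ((T ^^ n) y))"
    and middle: "\<forall>\<^sub>F n in sequentially. \<alpha> ((T ^^ n) y) ((T ^^ Suc n) y) \<le> A"
    and last: "(\<lambda>n. \<alpha> ((T ^^ Suc n) y) (T z)) \<longlonglongrightarrow> c" and "c * l < 1"
  shows "T z = z"
proof (rule ccontr)
  assume neq: "T z \<noteq> z"
  let ?x = "\<lambda>n. (T ^^ n) y"
  let ?s = "\<lambda>n. d (?x n) (?x (Suc n))"
  let ?r = "\<lambda>n. l * (d (?x n) z + ?s n + d z (T z))"
  have x_in: "?x i \<in> X" for i
    using y by (rule iterate_in)
  have step_0: "?s \<longlonglongrightarrow> 0"
    using orbit_gap_tendsto_0[OF y, of 1] by simp
  obtain B where first_lim: "(\<lambda>n. \<alpha> z (?x n)) \<longlonglongrightarrow> B"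
    using first by (auto simp: convergent_def)
  have avoids: "eventually (\<lambda>n. ?x n \<noteq> w) sequentially" for w
  proof -
    have "finite (?x -` {w})"
      using inj by (intro finite_vimageI) auto
    then have "eventually (\<lambda>n. n \<notin> ?x -` {w}) sequentially"
      by (simp add: eventually_cofinite vimage_def flip: cofinite_eq_sequentially)
    then show ?thesis by simp
  qed
  have "eventually (\<lambda>n. d z (T z) \<le> \<alpha> z (?x n) * d (?x n) z + A * ?s n
      + \<alpha> (?x (Suc n)) (T z) * ?r n) sequentially"
    using avoids[of z] avoids[of "T z"] middle
      avoids[of z, THEN eventually_sequentially_Suc[THEN iffD2]]
      avoids[of "T z", THEN eventually_sequentially_Suc[THEN iffD2]]
  proof eventually_elim
    case (elim n)
    have "?x n \<noteq> ?x (Suc n)"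
      using injD[OF inj, of n "Suc n"] by auto
    then have "distinct [z, T z, ?x n, ?x (Suc n)]"
      using elim neq by auto
    moreover have "{z, T z, ?x n, ?x (Suc n)} \<subseteq> X"
      using z x_in[of n] x_in[of "Suc n"] self_map by simp
    ultimately have "d z (T z) \<le> \<alpha> z (?x n) * d z (?x n) + \<alpha> (?x n) (?x (Suc n)) * ?s n
        + \<alpha> (?x (Suc n)) (T z) * d (?x (Suc n)) (T z)"
      by (intro rectangle)
    moreover have "d z (?x n) = d (?x n) z"
      using z by (intro commute x_in)
    moreover have "\<alpha> (?x n) (?x (Suc n)) * ?s n \<le> A * ?s n"
      using elim by (intro mult_right_mono nonneg x_in) auto
    moreover have "\<alpha> (?x (Suc n)) (T z) * d (?x (Suc n)) (T z) \<le> \<alpha> (?x (Suc n)) (T z) * ?r n"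
    proof (rule mult_left_mono)
      show "d (?x (Suc n)) (T z) \<le> ?r n"
        using contraction[OF x_in z, of n] by simp
      show "0 \<le> \<alpha> (?x (Suc n)) (T z)"
        using control_ge_1[OF x_in self_map[OF z], of "Suc n"] by linarith
    qed
    ultimately show ?case by simp
  qed
  moreover have "(\<lambda>n. \<alpha> z (?x n) * d (?x n) z + A * ?s n + \<alpha> (?x (Suc n)) (T z) * ?r n)
      \<longlonglongrightarrow> B * 0 + A * 0 + c * (l * (0 + 0 + d z (T z)))"
    by (intro tendsto_add tendsto_mult tendsto_const first_lim lim step_0 last)
  ultimately have "d z (T z) \<le> B * 0 + A * 0 + c * (l * (0 + 0 + d z (T z)))"
    by (intro tendsto_lowerbound) auto
  then have "(1 - c * l) * d z (T z) \<le> 0"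
    by (simp add: algebra_simps)
  then have "d z (T z) \<le> 0"
    using \<open>c * l < 1\<close> by (simp add: mult_le_0_iff)
  then show False
    using nonneg[OF z self_map[OF z]] zero_iff[OF z self_map[OF z]] neq by simp
qed

end

section \<open>Existence and uniqueness of the fixed point\<close>

lemma off_diagonal_tendsto_eventually_bounded:
  fixes f :: "nat \<times> nat \<Rightarrow> real"
  assumes "(f \<longlongrightarrow> L) off_diagonal_at_top"
  obtains N where "\<And>n m. \<lbrakk>n \<ge> N; m \<ge> N; n \<noteq> m\<rbrakk> \<Longrightarrow> f (n, m) \<le> L + 1"
proof -
  have "eventually (\<lambda>p. f p < L + 1) off_diagonal_at_top"
    using assms by (rule order_tendstoD) simp
  then have "eventually (\<lambda>(n, m). n \<noteq> m \<longrightarrow> f (n, m) < L + 1) (sequentially \<times>\<^sub>F sequentially)"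
    by (simp add: off_diagonal_at_top_def eventually_inf_principal case_prod_unfold)
  then show thesis
    using that by (fastforce simp: eventually_prod_sequentially)
qed

theorem theorem2p9:
  fixes X :: "'a set" and d \<alpha> :: "'a \<Rightarrow> 'a \<Rightarrow> real" and T :: "'a \<Rightarrow> 'a"
    and l :: real and x0 :: 'a and x :: "nat \<Rightarrow> 'a"
  assumes "controlled_rectangular_metric_space X d \<alpha>"
    and "seq_complete X d"
    and "T ` X \<subseteq> X"
    and "0 < l" and "l < 1 / 3"
    and "\<And>y z. y \<in> X \<Longrightarrow> z \<in> X \<Longrightarrow> d (T y) (T z) \<le> l * (d y z + d y (T y) + d z (T z))"
    and "x0 \<in> X"
    and "\<And>n. x n = (T ^^ n) x0"
    and "\<And>m. m \<ge> 1 \<Longrightarrow> convergent (\<lambda>i. \<alpha> (x i) (x m) *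
           ((\<alpha> (x (i + 1)) (x (i + 2)) + \<alpha> (x (i + 2)) (x (i + 3))) /
            (\<alpha> (x i) (x (i + 1)) + \<alpha> (x (i + 1)) (x (i + 2)))))"
    and "(SUP m\<in>{1..}. ereal (lim (\<lambda>i. \<alpha> (x i) (x m) *
           ((\<alpha> (x (i + 1)) (x (i + 2)) + \<alpha> (x (i + 2)) (x (i + 3))) /
            (\<alpha> (x i) (x (i + 1)) + \<alpha> (x (i + 1)) (x (i + 2))))))) < ereal (1 / l^2)"
    and "\<And>y. y \<in> X \<Longrightarrow> convergent (\<lambda>n. \<alpha> (x n) y)"
    and "\<And>y. y \<in> X \<Longrightarrow> convergent (\<lambda>n. \<alpha> y (x n))"
    and "\<exists>L. ((\<lambda>(n, m). \<alpha> (x n) (x m)) \<longlongrightarrow> L) off_diagonal_at_top"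
    and "convergent (\<lambda>n. \<alpha> (x n) (T (T (x n))))"
    and "lim (\<lambda>n. \<alpha> (x n) (T (T (x n)))) < 1 / l"
    and "\<And>y. y \<in> X \<Longrightarrow> convergent (\<lambda>n. \<alpha> (T (x n)) (T y))"
    and "\<And>y. y \<in> X \<Longrightarrow> lim (\<lambda>n. \<alpha> (T (x n)) (T y)) < 1 / l"
    and "\<And>y. y \<in> X \<Longrightarrow> convergent (\<lambda>n. \<alpha> (T y) (T (x n)))"
    and "\<And>y. y \<in> X \<Longrightarrow> lim (\<lambda>n. \<alpha> (T y) (T (x n))) < 1 / l"
  shows "\<exists>!y. y \<in> X \<and> T y = y"
proof -
  interpret reich_contraction X d \<alpha> T l
    using assms(1,3-6)
    by (auto simp: reich_contraction_def reich_contraction_axioms_def)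
  have orbit: "x = (\<lambda>n. (T ^^ n) x0)"
    using assms(8) by blast
  have "\<exists>z\<in>X. T z = z"
  proof (rule ccontr)
    assume "\<not> (\<exists>z\<in>X. T z = z)"
    then have inj: "inj (\<lambda>n. (T ^^ n) x0)"
      using \<open>x0 \<in> X\<close> by (intro orbit_inj_if_no_fixed_point) auto
    obtain L where "((\<lambda>(n, m). \<alpha> (x n) (x m)) \<longlongrightarrow> L) off_diagonal_at_top"
      using assms(13) by blast
    from off_diagonal_tendsto_eventually_bounded[OF this] obtain N where
      bound: "\<And>n m. \<lbrakk>n \<ge> N; m \<ge> N; n \<noteq> m\<rbrakk> \<Longrightarrow> \<alpha> ((T ^^ n) x0) ((T ^^ m) x0) \<le> L + 1"
      unfolding orbit by auto
    have "seq_Cauchy d (\<lambda>n. (T ^^ n) x0)"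
      using orbit_Cauchy[OF \<open>x0 \<in> X\<close> inj bound] .
    moreover have "range (\<lambda>n. (T ^^ n) x0) \<subseteq> X"
      using iterate_in[OF \<open>x0 \<in> X\<close>] by blast
    ultimately obtain z where z: "z \<in> X" and lim: "(\<lambda>n. d ((T ^^ n) x0) z) \<longlonglongrightarrow> 0"
      using \<open>seq_complete X d\<close> unfolding seq_complete_def seq_converges_to_def by blast
    have "T z = z"
    proof (rule orbit_limit_fixed[OF \<open>x0 \<in> X\<close> inj z lim])
      show "convergent (\<lambda>n. \<alpha> z ((T ^^ n) x0))"
        using assms(12)[OF z] by (simp add: orbit)
      show "\<forall>\<^sub>F n in sequentially. \<alpha> ((T ^^ n) x0) ((T ^^ Suc n) x0) \<le> L + 1"
        by (intro eventually_sequentiallyI[of N] bound) auto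
      show "(\<lambda>n. \<alpha> ((T ^^ Suc n) x0) (T z)) \<longlonglongrightarrow> lim (\<lambda>n. \<alpha> (T (x n)) (T z))"
        using assms(16)[OF z] by (simp add: convergent_LIMSEQ_iff orbit)
      show "lim (\<lambda>n. \<alpha> (T (x n)) (T z)) * l < 1"
        using assms(17)[OF z] l_pos by (simp add: field_simps)
    qed
    then show False
      using \<open>\<not> (\<exists>z\<in>X. T z = z)\<close> z by blast
  qed
  then show ?thesis
    using fixed_points_unique by blast
qed

end
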